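(* Let $d_1,d_2\in\mathbb N$, let $(\mathbf X,Y),(\mathbf X_1,Y_1),\dots,(\mathbf X_n,Y_n)$ be i.i.d. with values in $[0,1]^{d_1\times d_2}\times\{-1,1\}$, let $\eta(\mathbf x)=\mathbf P(Y=1\mid\mathbf X=\mathbf x)$, and let $\varphi(x)=\log(1+\exp(-x))$. Let $\mathcal F_n$ be a class of (measurable) real-valued functions on $[0,1]^{d_1\times d_2}$, and let $$\hat f_n\in\arg\min_{g\in\mathcal F_n}\frac1n\sum_{i=1}^n\varphi(Y_ig(\mathbf X_i)).$$ Let $f^*=2\eta-1$ and $f_\varphi^*=\log\frac{\eta}{1-\eta}$. Then: (a) $$\mathbf E\{\mathcal E(\hat f_n,f^* )\}\le\sqrt2\cdot\mathbf E\{\mathcal E^\varphi(\hat f_n,f_\varphi^* )^{1/2}\}.$$ (b) $$\mathbf E\{\mathcal E(\hat f_n,f^* )\}\le2\cdot\mathbf E\{\mathcal E^\varphi(\hat f_n,f_\varphi^* )\}+4\cdot\mathcal E^\varphi(f_\varphi^* ).$$ In both parts the expectation is taken over the training data $\mathcal D_n=\{(\mathbf X_i,Y_i)\}_{i=1}^n$.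
   Context: $\mathrm{sgn}(x)=1$ if $x>0$ and $-1$ otherwise. $\mathcal E(g)=\mathbf P(Y\,\mathrm{sgn}(g(\mathbf X))\le0)$ is the $0$-$1$ risk and $\mathcal E^\varphi(g)=\mathbf E(\varphi(Yg(\mathbf X)))$ the $\varphi$-risk; for data-dependent $g$ these are over $(\mathbf X,Y)$ independent of $\mathcal D_n$, with $g$ held fixed. $\mathcal E(g,f^* )=\mathcal E(g)-\mathcal E(f^* )$ is the excess risk ($f^*$ minimizes $\mathcal E$ over all measurable functions), and $\mathcal E^\varphi(g,f_\varphi^* )=\mathcal E^\varphi(g)-\mathcal E^\varphi(f_\varphi^* )$ is the excess $\varphi$-risk ($f_\varphi^*$ minimizes $\mathcal E^\varphi$ over measurable functions). The function $f_\varphi^*$ takes the values $+\infty$ where $\eta=1$ and $-\infty$ where $\eta=0$, with $\varphi(+\infty)=0$, $\varphi(-\infty)=+\infty$ and $0\cdot\infty=0$, where $\mathcal E^\varphi(g)=\int(\eta(\mathbf x)\varphi(g(\mathbf x))+(1-\eta(\mathbf x))\varphi(-g(\mathbf x)))\,\mathbf P_{\mathbf X}(d\mathbf x)$. *)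

theory Defs
  imports "HOL-Probability.Probability"
begin

definition unit_cube :: "(real ^ 'd2 ^ 'd1) set" where
  "unit_cube = {x. \<forall>i j. 0 \<le> x $ i $ j \<and> x $ i $ j \<le> 1}"

abbreviation cube_space :: "(real ^ 'd2 ^ 'd1) measure" where
  "cube_space \<equiv> restrict_space borel unit_cube"

abbreviation obs_space :: "((real ^ 'd2 ^ 'd1) \<times> real) measure" where
  "obs_space \<equiv> cube_space \<Otimes>\<^sub>M count_space {-1, 1}"

text \<open>The \<open>\<phi>\<close>-risks may be infinite and the minimizer of the \<open>\<phi>\<close>-risk takes
  infinite values, so \<open>\<phi>\<close>, the square root and the expectation are needed on the extended
  reals. The expectation is the difference of the integrals of the positive and the negative part;
  \<^term>\<open>e2ennreal\<close> sends negative numbers to \<open>0\<close>. It is the usual expectation for measurable \<open>f\<close>;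
  for a non-measurable \<open>f \<ge> 0\<close> it is the lower integral.\<close>

definition ereal_expectation :: "'w measure \<Rightarrow> ('w \<Rightarrow> ereal) \<Rightarrow> ereal" where
  "ereal_expectation M f =
     enn2ereal (\<integral>\<^sup>+ \<omega>. e2ennreal (f \<omega>) \<partial>M) - enn2ereal (\<integral>\<^sup>+ \<omega>. e2ennreal (- f \<omega>) \<partial>M)"

definition ereal_sqrt :: "ereal \<Rightarrow> ereal" where
  "ereal_sqrt z = (if \<bar>z\<bar> = \<infinity> then z else ereal (sqrt (real_of_ereal z)))"

definition logistic_loss :: "real \<Rightarrow> real" where
  "logistic_loss x = ln (1 + exp (- x))"

definition ereal_logistic_loss :: "ereal \<Rightarrow> ereal" where
  "ereal_logistic_loss z =
     (if z = \<infinity> then 0 else if z = -\<infinity> then \<infinity> else ereal (logistic_loss (real_of_ereal z)))"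

text \<open>Unlike the library's \<^const>\<open>sgn\<close>, this sign is \<open>-1\<close> at \<open>0\<close>.\<close>

definition class_sgn :: "real \<Rightarrow> real" where
  "class_sgn x = (if x > 0 then 1 else -1)"

definition risk :: "'w measure \<Rightarrow> ('w \<Rightarrow> 'x) \<Rightarrow> ('w \<Rightarrow> real) \<Rightarrow> ('x \<Rightarrow> real) \<Rightarrow> real" where
  "risk M X Y g = measure M {\<omega> \<in> space M. Y \<omega> * class_sgn (g (X \<omega>)) \<le> 0}"

definition phi_risk ::
  "'w measure \<Rightarrow> ('w \<Rightarrow> 'x) \<Rightarrow> ('w \<Rightarrow> real) \<Rightarrow> ('x \<Rightarrow> ereal) \<Rightarrow> ereal" where
  "phi_risk M X Y g =
     ereal_expectation M (\<lambda>\<omega>. ereal_logistic_loss (ereal (Y \<omega>) * g (X \<omega>)))"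

definition excess_risk ::
  "'w measure \<Rightarrow> ('w \<Rightarrow> 'x) \<Rightarrow> ('w \<Rightarrow> real) \<Rightarrow> ('x \<Rightarrow> real) \<Rightarrow> ('x \<Rightarrow> real) \<Rightarrow> real" where
  "excess_risk M X Y g f = risk M X Y g - risk M X Y f"

definition excess_phi_risk ::
  "'w measure \<Rightarrow> ('w \<Rightarrow> 'x) \<Rightarrow> ('w \<Rightarrow> real) \<Rightarrow> ('x \<Rightarrow> ereal) \<Rightarrow> ('x \<Rightarrow> ereal) \<Rightarrow> ereal" where
  "excess_phi_risk M X Y g f = phi_risk M X Y g - phi_risk M X Y f"

text \<open>\<open>\<eta>\<close> is a version of \<open>x \<mapsto> P(Y = 1 | X = x)\<close>: a measurable function on the cube
  such that \<open>\<eta>(X)\<close> is the conditional expectation of the indicator of \<open>Y = 1\<close> given the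
  \<open>\<sigma>\<close>-algebra generated by \<open>X\<close>.\<close>

definition is_cond_prob_one ::
  "'w measure \<Rightarrow> ('w \<Rightarrow> real ^ 'd2 ^ 'd1) \<Rightarrow> ('w \<Rightarrow> real) \<Rightarrow> (real ^ 'd2 ^ 'd1 \<Rightarrow> real) \<Rightarrow> bool" where
  "is_cond_prob_one M X Y \<eta> \<longleftrightarrow>
     \<eta> \<in> borel_measurable cube_space \<and>
     (AE \<omega> in M. \<eta> (X \<omega>) =
        real_cond_exp M (vimage_algebra (space M) X cube_space)
          (indicator {\<omega> \<in> space M. Y \<omega> = 1}) \<omega>)"

definition f_star :: "('x \<Rightarrow> real) \<Rightarrow> 'x \<Rightarrow> real" where
  "f_star \<eta> x = 2 * \<eta> x - 1"

definition f_phi_star :: "('x \<Rightarrow> real) \<Rightarrow> 'x \<Rightarrow> ereal" where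
  "f_phi_star \<eta> x =
     (if \<eta> x = 1 then \<infinity> else if \<eta> x = 0 then -\<infinity> else ereal (ln (\<eta> x / (1 - \<eta> x))))"

definition empirical_phi_risk :: "nat \<Rightarrow> (nat \<Rightarrow> 'x \<times> real) \<Rightarrow> ('x \<Rightarrow> real) \<Rightarrow> real" where
  "empirical_phi_risk n D g =
     1 / real n * (\<Sum>i = 1..n. logistic_loss (snd (D i) * g (fst (D i))))"

definition training_data ::
  "nat \<Rightarrow> (nat \<Rightarrow> 'w \<Rightarrow> 'x) \<Rightarrow> (nat \<Rightarrow> 'w \<Rightarrow> real) \<Rightarrow> 'w \<Rightarrow> nat \<Rightarrow> 'x \<times> real" where
  "training_data n Xs Ys \<omega> = (\<lambda>i\<in>{1..n}. (Xs i \<omega>, Ys i \<omega>))"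

text \<open>\<open>(X, Y), (X\<^sub>1, Y\<^sub>1), \<dots>, (X\<^sub>n, Y\<^sub>n)\<close> are i.i.d.; the pair \<open>(X, Y)\<close> gets index \<open>0\<close>, so
  \<open>Xs 0\<close> and \<open>Ys 0\<close> are not used. Independence of random variables with target
  \<^term>\<open>obs_space\<close> includes that the pairs are measurable with values in the cube times
  \<open>{-1, 1}\<close>.\<close>

definition iid_sample ::
  "'w measure \<Rightarrow> ('w \<Rightarrow> real ^ 'd2 ^ 'd1) \<Rightarrow> ('w \<Rightarrow> real) \<Rightarrow> nat \<Rightarrow>
    (nat \<Rightarrow> 'w \<Rightarrow> real ^ 'd2 ^ 'd1) \<Rightarrow> (nat \<Rightarrow> 'w \<Rightarrow> real) \<Rightarrow> bool" where
  "iid_sample M X Y n Xs Ys \<longleftrightarrow>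
     prob_space.indep_vars M (\<lambda>_. obs_space)
       (\<lambda>i \<omega>. if i = 0 then (X \<omega>, Y \<omega>) else (Xs i \<omega>, Ys i \<omega>)) {0..n} \<and>
     (\<forall>i\<in>{1..n}. distr M obs_space (\<lambda>\<omega>. (Xs i \<omega>, Ys i \<omega>)) =
                  distr M obs_space (\<lambda>\<omega>. (X \<omega>, Y \<omega>)))"

lemma ereal_logistic_loss_nonneg: "0 \<le> ereal_logistic_loss z"
  by (simp add: ereal_logistic_loss_def logistic_loss_def)

lemma ereal_logistic_loss_measurable [measurable]:
  "ereal_logistic_loss \<in> borel_measurable borel"
  unfolding ereal_logistic_loss_def logistic_loss_def by measurable

text \<open>The \<open>\<phi>\<close>-risk in terms of \<open>\<eta>\<close>, also for infinite-valued \<open>g\<close> such as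
  \<^term>\<open>f_phi_star \<eta>\<close>. The library's product on \<^typ>\<open>ereal\<close> satisfies
  \<open>0 * \<infinity> = 0\<close>.\<close>

lemma phi_risk_conditional:
  fixes X :: "'w \<Rightarrow> real ^ 'd2 ^ 'd1"
  assumes "prob_space M"
    and XY: "(\<lambda>\<omega>. (X \<omega>, Y \<omega>)) \<in> measurable M obs_space"
    and \<eta>: "is_cond_prob_one M X Y \<eta>"
    and g [measurable]: "g \<in> borel_measurable cube_space"
  shows "phi_risk M X Y g = ereal_expectation (distr M cube_space X)
    (\<lambda>x. ereal (\<eta> x) * ereal_logistic_loss (g x) +
         ereal (1 - \<eta> x) * ereal_logistic_loss (- g x))"
proof -
  interpret prob_space M by fact
  have X [measurable]: "X \<in> measurable M cube_space"
    using measurable_compose[OF XY measurable_fst] by simp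
  have Y: "Y \<in> measurable M (count_space {-1, 1})"
    using measurable_compose[OF XY measurable_snd] by simp
  have Y_cases: "Y \<omega> = -1 \<or> Y \<omega> = 1" if "\<omega> \<in> space M" for \<omega>
    using measurable_space[OF Y that] by auto
  have [measurable]: "\<eta> \<in> borel_measurable cube_space"
    using \<eta> by (simp add: is_cond_prob_one_def)
  define G where "G = vimage_algebra (space M) X cube_space"
  have X_space: "X \<in> space M \<rightarrow> space cube_space"
    using X by (rule measurable_space[THEN funcsetI])
  have XG [measurable]: "X \<in> measurable G cube_space"
    unfolding G_def by (rule measurable_vimage_algebra1[OF X_space])
  have sub: "subalgebra M G"
    unfolding subalgebra_def G_def
    using X by (auto simp: measurable_iff_sets)
  interpret finite_measure_subalgebra M G
    by standard (fact sub)
  define A where "A = {\<omega> \<in> space M. Y \<omega> = 1}"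
  have A [measurable]: "A \<in> sets M"
  proof -
    have "A = Y -` {1} \<inter> space M" by (auto simp: A_def)
    then show ?thesis using measurable_sets[OF Y, of "{1}"] by simp
  qed
  define B where "B = space M - A"
  have B [measurable]: "B \<in> sets M" by (simp add: B_def)
  define a where "a = nn_cond_exp M G (\<lambda>\<omega>. ennreal (indicator A \<omega>))"
  define b where "b = nn_cond_exp M G (\<lambda>\<omega>. ennreal (indicator B \<omega>))"
  have "AE \<omega> in M. a \<omega> + b \<omega> =
      nn_cond_exp M G (\<lambda>\<omega>. ennreal (indicator A \<omega>) + ennreal (indicator B \<omega>)) \<omega>"
    unfolding a_def b_def by (rule nn_cond_exp_sum) auto
  moreover have "AE \<omega> in M.
      nn_cond_exp M G (\<lambda>\<omega>. ennreal (indicator A \<omega>) + ennreal (indicator B \<omega>)) \<omega> =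
      nn_cond_exp M G (\<lambda>\<omega>. 1) \<omega>"
    by (rule nn_cond_exp_cong) (auto simp: B_def indicator_def, measurable)
  moreover have "AE \<omega> in M. 1 = nn_cond_exp M G (\<lambda>\<omega>. 1) \<omega>"
    by (rule nn_cond_exp_F_meas) auto
  ultimately have ab: "AE \<omega> in M. a \<omega> + b \<omega> = 1" by eventually_elim auto
  have "AE \<omega> in M. nn_cond_exp M G (\<lambda>\<omega>. ennreal (- indicator A \<omega>)) \<omega> = nn_cond_exp M G (\<lambda>\<omega>. 0) \<omega>"
    by (rule nn_cond_exp_cong) (auto simp: indicator_def ennreal_neg)
  moreover have "AE \<omega> in M. 0 = nn_cond_exp M G (\<lambda>\<omega>. 0) \<omega>"
    by (rule nn_cond_exp_F_meas) auto
  moreover have "AE \<omega> in M. \<eta> (X \<omega>) = real_cond_exp M G (indicator A) \<omega>"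
    using \<eta> by (simp add: is_cond_prob_one_def G_def A_def)
  ultimately have \<eta>_a: "AE \<omega> in M. \<eta> (X \<omega>) = enn2real (a \<omega>)"
    by eventually_elim (simp add: real_cond_exp_def a_def)
  have AE: "AE \<omega> in M. a \<omega> = ennreal (\<eta> (X \<omega>)) \<and> b \<omega> = ennreal (1 - \<eta> (X \<omega>)) \<and>
      0 \<le> \<eta> (X \<omega>) \<and> \<eta> (X \<omega>) \<le> 1"
    using ab \<eta>_a
  proof eventually_elim
    case (elim \<omega>)
    show ?case
      using elim by (cases "a \<omega>"; cases "b \<omega>")
        (auto simp flip: ennreal_plus ennreal_1)
  qed
  let ?p = "\<lambda>x. e2ennreal (ereal_logistic_loss (g x))"
  let ?m = "\<lambda>x. e2ennreal (ereal_logistic_loss (- g x))"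
  let ?f = "\<lambda>x. ereal (\<eta> x) * ereal_logistic_loss (g x) +
         ereal (1 - \<eta> x) * ereal_logistic_loss (- g x)"
  have "(\<integral>\<^sup>+ \<omega>. e2ennreal (ereal_logistic_loss (ereal (Y \<omega>) * g (X \<omega>))) \<partial>M) =
      (\<integral>\<^sup>+ \<omega>. ?p (X \<omega>) * ennreal (indicator A \<omega>) + ?m (X \<omega>) * ennreal (indicator B \<omega>) \<partial>M)"
  proof (rule nn_integral_cong)
    fix \<omega> assume \<omega>: "\<omega> \<in> space M"
    have "ereal (-1) * u = - u" for u :: ereal
      by (cases u) auto
    with Y_cases[OF \<omega>] \<omega>
    show "e2ennreal (ereal_logistic_loss (ereal (Y \<omega>) * g (X \<omega>))) =
        ?p (X \<omega>) * ennreal (indicator A \<omega>) + ?m (X \<omega>) * ennreal (indicator B \<omega>)"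
      by (auto simp: A_def B_def simp flip: one_ereal_def)
  qed
  also have "\<dots> = (\<integral>\<^sup>+ \<omega>. ?p (X \<omega>) * a \<omega> \<partial>M) + (\<integral>\<^sup>+ \<omega>. ?m (X \<omega>) * b \<omega> \<partial>M)"
    unfolding a_def b_def by (subst nn_integral_add) (auto simp: nn_cond_exp_intg)
  also have "\<dots> = (\<integral>\<^sup>+ \<omega>. ?p (X \<omega>) * a \<omega> + ?m (X \<omega>) * b \<omega> \<partial>M)"
    unfolding a_def b_def by (subst nn_integral_add) auto
  also have "\<dots> = (\<integral>\<^sup>+ \<omega>. e2ennreal (?f (X \<omega>)) \<partial>M)"
  proof (rule nn_integral_cong_AE)
    have *: "e2ennreal (ereal c * u) = e2ennreal u * ennreal c" if "0 \<le> c" "0 \<le> u" for c u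
      using that by (cases u) (auto simp: ennreal_mult mult.commute ennreal_top_mult ennreal_mult_top)
    have **: "e2ennreal (u + v) = e2ennreal u + e2ennreal v" if "0 \<le> u" "0 \<le> v" for u v
      using that by (cases u; cases v) auto
    show "AE \<omega> in M. ?p (X \<omega>) * a \<omega> + ?m (X \<omega>) * b \<omega> = e2ennreal (?f (X \<omega>))"
      using AE by eventually_elim
        (simp add: * ** ereal_logistic_loss_nonneg)
  qed
  also have "\<dots> = (\<integral>\<^sup>+ x. e2ennreal (?f x) \<partial>distr M cube_space X)"
    by (subst nn_integral_distr) auto
  finally have pos: "(\<integral>\<^sup>+ \<omega>. e2ennreal (ereal_logistic_loss (ereal (Y \<omega>) * g (X \<omega>))) \<partial>M) = \<dots>" .
  have neg1: "(\<integral>\<^sup>+ \<omega>. e2ennreal (- ereal_logistic_loss (ereal (Y \<omega>) * g (X \<omega>))) \<partial>M) = 0"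
    by (simp add: e2ennreal_neg ereal_logistic_loss_nonneg)
  have "(\<integral>\<^sup>+ x. e2ennreal (- ?f x) \<partial>distr M cube_space X) = (\<integral>\<^sup>+ \<omega>. e2ennreal (- ?f (X \<omega>)) \<partial>M)"
    by (subst nn_integral_distr) auto
  also have "\<dots> = (\<integral>\<^sup>+ \<omega>. 0 \<partial>M)"
  proof (rule nn_integral_cong_AE)
    show "AE \<omega> in M. e2ennreal (- ?f (X \<omega>)) = 0"
      using AE by eventually_elim
        (auto intro!: e2ennreal_neg add_nonneg_nonneg simp: ereal_logistic_loss_nonneg)
  qed
  finally show ?thesis
    unfolding phi_risk_def ereal_expectation_def pos neg1 by simp
qed

end

theory Submission
  imports Defs
begin

text \<open>
  Both bounds hold for every fixed measurable classifier \<open>g\<close>, and hence for the one chosen from any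
  outcome of the training data; averaging over the outcomes gives the theorem.

  For (a), condition on \<open>X = x\<close> and write \<open>p = \<eta> x\<close> and \<open>z = g x\<close>. The conditional \<open>\<phi>\<close>-risk is
  \<open>p \<phi>(z) + (1 - p) \<phi>(-z)\<close>. Its infimum over \<open>z\<close> is the entropy \<open>H(p)\<close> of a Bernoulli variable,
  which is the value that \<open>f_phi_star\<close> produces. Its value at a \<open>z\<close> on the wrong side of the Bayes
  rule is at least \<open>ln 2\<close>, the value at \<open>z = 0\<close>. Since \<open>ln 2 - H(p)\<close> is the Kullback-Leibler
  divergence from the fair coin, Pinsker's inequality bounds it below by \<open>(2p - 1)\<^sup>2 / 2\<close>, while the
  conditional excess \<open>0\<close>-\<open>1\<close> risk \<open>D\<close> is \<open>\<bar>2p - 1\<bar>\<close> on the wrong side and \<open>0\<close> elsewhere. So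
  \<open>D\<^sup>2 / 2\<close> is at most the conditional excess \<open>\<phi>\<close>-risk (\<open>excess_loss_calibration\<close>), and
  \<open>(E D)\<^sup>2 \<le> E D\<^sup>2\<close> integrates this to \<open>excess_phi_risk_lower\<close>, which is (a) for fixed \<open>g\<close>.

  For (b), the \<open>0\<close>-\<open>1\<close> loss is at most twice the logistic loss, because a misclassified point has
  \<open>\<phi>\<close>-loss at least \<open>ln 2 \<ge> 1 / 2\<close>. Hence the excess risk is at most twice the \<open>\<phi>\<close>-risk of \<open>g\<close>,
  which is the excess \<open>\<phi>\<close>-risk plus the finite \<open>\<phi>\<close>-risk of \<open>f_phi_star\<close>
  (\<open>excess_risk_le_excess_phi_risk\<close>).

  The chosen classifier may depend on the training data in a non-measurable way, so the outer
  expectations are lower integrals. These are still monotone, and they are compatible with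
  increasing affine maps (\<open>ereal_expectation_affine_bound\<close>), which is all the averaging step uses.
\<close>

section \<open>The logistic loss at a single point\<close>

lemma logistic_loss_minus: "logistic_loss (- z) = logistic_loss z + z"
proof -
  have "1 + exp z = exp z * (1 + exp (- z))"
    by (simp add: algebra_simps flip: exp_add)
  then have "ln (1 + exp z) = ln (exp z) + ln (1 + exp (- z))"
    by (simp only: ln_mult_pos exp_gt_zero add_pos_pos zero_less_one)
  then show ?thesis by (simp add: logistic_loss_def)
qed

definition pointwise_risk :: "real \<Rightarrow> real \<Rightarrow> real" where
  "pointwise_risk p z = p * logistic_loss z + (1 - p) * logistic_loss (- z)"

definition bernoulli_entropy :: "real \<Rightarrow> real" where
  "bernoulli_entropy p = - (p * ln p) - (1 - p) * ln (1 - p)"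

lemma pointwise_risk_nonneg:
  assumes "0 \<le> p" "p \<le> 1"
  shows "0 \<le> pointwise_risk p z"
  using assms by (simp add: pointwise_risk_def logistic_loss_def)

lemma pointwise_risk_eq: "pointwise_risk p z = logistic_loss (- z) - p * z"
  by (simp add: pointwise_risk_def logistic_loss_minus algebra_simps)

text \<open>
  Since \<open>\<phi>(-z) = ln (2 cosh (z / 2)) + z / 2\<close>, the pointwise risk is \<open>ln (2 cosh (z / 2))\<close> minus a
  linear term with slope \<open>(2p - 1) / 2\<close>. The two bounds below are \<open>1 \<le> cosh (z / 2) \<le> exp (z\<^sup>2 / 8)\<close>.
\<close>
lemma pointwise_risk_lower: "ln 2 - (2 * p - 1) * z / 2 \<le> pointwise_risk p z"
proof -
  have "2 * exp (z / 2) \<le> 1 + exp z"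
    using sum_squares_bound[of 1 "exp (z / 2)"] by (simp add: power2_eq_square flip: exp_add)
  then have "ln (2 * exp (z / 2)) \<le> ln (1 + exp z)"
    by (subst ln_le_cancel_iff) (auto intro: add_pos_pos)
  then have "ln 2 + z / 2 \<le> logistic_loss (- z)"
    by (simp add: logistic_loss_def ln_mult)
  then show ?thesis by (simp add: pointwise_risk_eq field_simps)
qed

lemma pointwise_risk_upper:
  "pointwise_risk p z \<le> ln 2 - (2 * p - 1) * z / 2 + z\<^sup>2 / 8"
proof -
  \<comment> \<open>This is Hoeffding's lemma for a fair coin with values in \<open>{0, h}\<close>.\<close>
  have *: "logistic_loss (- h) \<le> ln 2 + h / 2 + h\<^sup>2 / 8" if "0 \<le> h" for h
  proof -
    have "ln (1 + exp h) - ln 2 = ln ((1 + exp h) / 2)"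
      by (simp add: ln_div add_pos_pos pos_add_strict less_imp_neq[symmetric])
    also have "(1 + exp h) / 2 = 1 + 1 / 2 * (exp h - 1)" by (simp add: field_simps)
    finally show ?thesis
      using Hoeffdings_lemma_aux[OF that, of "1 / 2"] by (simp add: logistic_loss_def)
  qed
  have "logistic_loss (- z) \<le> ln 2 + z / 2 + z\<^sup>2 / 8"
  proof (cases "0 \<le> z")
    case False
    then show ?thesis using *[of "- z"] by (simp add: logistic_loss_minus)
  qed (rule *)
  then show ?thesis by (simp add: pointwise_risk_eq field_simps)
qed

text \<open>
  This is Gibbs' inequality: \<open>\<phi>(z) = - ln s\<close> and \<open>\<phi>(-z) = - ln (1 - s)\<close> for the logistic
  probability \<open>s = 1 / (1 + exp (-z))\<close>, so the pointwise risk is the cross entropy of \<open>p\<close> and \<open>s\<close>.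
\<close>
lemma bernoulli_entropy_le_pointwise_risk:
  assumes "0 \<le> p" "p \<le> 1"
  shows "bernoulli_entropy p \<le> pointwise_risk p z"
proof -
  have *: "- (q * ln q) - q * logistic_loss z \<le> 1 / (1 + exp (- z)) - q" if "0 \<le> q" for q z
  proof (cases "q = 0")
    case False
    define s where "s = 1 / (1 + exp (- z))"
    have s: "0 < s" by (simp add: s_def add_pos_pos)
    have "logistic_loss z = - ln s"
      by (simp add: s_def logistic_loss_def ln_div add_pos_pos)
    then have "- (q * ln q) - q * logistic_loss z = q * ln (s / q)"
      using False that s by (simp add: ln_div algebra_simps)
    also have "\<dots> \<le> q * (s / q - 1)"
      using False that s by (intro mult_left_mono ln_le_minus_one) auto
    also have "q * (s / q - 1) = s - q" using False by (simp add: field_simps)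
    finally show ?thesis by (simp add: s_def)
  qed (simp add: add_nonneg_nonneg)
  have "1 / (1 + exp (- z)) + 1 / (1 + exp z) = 1"
    by (simp add: exp_minus field_simps add_pos_pos less_imp_neq[symmetric])
  then show ?thesis
    using *[of p z] *[of "1 - p" "- z"] assms
    by (simp add: bernoulli_entropy_def pointwise_risk_def)
qed

lemma bernoulli_entropy_nonneg:
  assumes "0 \<le> p" "p \<le> 1"
  shows "0 \<le> bernoulli_entropy p"
proof -
  have "q * ln q \<le> 0" if "0 \<le> q" "q \<le> 1" for q :: real
    using that by (cases "q = 0") (auto simp: mult_le_0_iff)
  from this[of p] this[of "1 - p"] show ?thesis
    using assms by (simp add: bernoulli_entropy_def)
qed

text \<open>
  Pinsker's inequality against the fair coin. The entropy is a lower bound for the pointwise risk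
  at every \<open>z\<close>, so it suffices to pick the \<open>z\<close> that minimizes the quadratic upper bound,
  \<open>z = 2 (2p - 1)\<close>.
\<close>
lemma bernoulli_entropy_upper:
  assumes "0 \<le> p" "p \<le> 1"
  shows "bernoulli_entropy p \<le> ln 2 - (2 * p - 1)\<^sup>2 / 2"
  using bernoulli_entropy_le_pointwise_risk[OF assms, of "2 * (2 * p - 1)"]
    pointwise_risk_upper[of p "2 * (2 * p - 1)"]
  by (simp add: power2_eq_square field_simps)

text \<open>
  The difference of the conditional misclassification probabilities of the score \<open>z\<close> and of the
  Bayes score \<open>2p - 1\<close>; a score of \<open>0\<close> predicts the label \<open>-1\<close>.
\<close>
definition excess_loss :: "real \<Rightarrow> real \<Rightarrow> real" where
  "excess_loss p z = (2 * p - 1) * (of_bool (z \<le> 0) - of_bool (2 * p - 1 \<le> 0))"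

lemma excess_loss_calibration:
  assumes "0 \<le> p" "p \<le> 1"
  shows "(excess_loss p z)\<^sup>2 / 2 + bernoulli_entropy p \<le> pointwise_risk p z"
proof (cases "excess_loss p z = 0")
  case True
  then show ?thesis using bernoulli_entropy_le_pointwise_risk[OF assms] by simp
next
  case False
  then have wrong: "(2 * p - 1) * z \<le> 0" and sq: "(excess_loss p z)\<^sup>2 = (2 * p - 1)\<^sup>2"
    by (auto simp: excess_loss_def of_bool_def mult_le_0_iff power2_eq_square split: if_splits)
  have "ln 2 \<le> pointwise_risk p z"
    using pointwise_risk_lower[of p z] wrong by simp
  then show ?thesis using bernoulli_entropy_upper[OF assms] sq by simp
qed

lemma conditional_loss_real:
  "ereal p * ereal_logistic_loss (ereal z) + ereal (1 - p) * ereal_logistic_loss (- ereal z) =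
    ereal (pointwise_risk p z)"
  by (simp add: ereal_logistic_loss_def pointwise_risk_def)

text \<open>
  In the interior the log-odds turn the logistic loss into \<open>- ln p\<close> and \<open>- ln (1 - p)\<close>. At the
  endpoints the product \<open>0 * \<infinity> = 0\<close> on the left corresponds to \<open>0 * ln 0 = 0\<close> in the entropy.
\<close>
lemma conditional_loss_f_phi_star:
  assumes "0 \<le> \<eta> x" "\<eta> x \<le> 1"
  shows "ereal (\<eta> x) * ereal_logistic_loss (f_phi_star \<eta> x) +
      ereal (1 - \<eta> x) * ereal_logistic_loss (- f_phi_star \<eta> x) =
    ereal (bernoulli_entropy (\<eta> x))"
proof -
  consider "\<eta> x = 0" | "\<eta> x = 1" | "0 < \<eta> x" "\<eta> x < 1" using assms by linarith
  then show ?thesis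
  proof cases
    case 3
    define p where "p = \<eta> x"
    have p: "0 < p" "p < 1" using 3 by (simp_all add: p_def)
    have odds: "exp (ln (p / (1 - p))) = p / (1 - p)" using p by (simp add: exp_ln)
    have "1 + exp (- ln (p / (1 - p))) = 1 / p"
      using p unfolding exp_minus odds by (simp add: field_simps)
    then have 1: "logistic_loss (ln (p / (1 - p))) = - ln p"
      using p by (simp add: logistic_loss_def ln_div)
    have "1 + exp (ln (p / (1 - p))) = 1 / (1 - p)"
      using p unfolding odds by (simp add: field_simps)
    then have 2: "logistic_loss (- ln (p / (1 - p))) = - ln (1 - p)"
      using p by (simp add: logistic_loss_def ln_div)
    show ?thesis
      using p unfolding p_def[symmetric]
      by (simp add: f_phi_star_def flip: p_def)
        (simp add: ereal_logistic_loss_def 1 2 bernoulli_entropy_def)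
  qed (simp_all add: f_phi_star_def ereal_logistic_loss_def bernoulli_entropy_def
        zero_ereal_def[symmetric] one_ereal_def[symmetric])
qed

section \<open>Expectations of extended real functions\<close>

lemma ereal_expectation_nonneg:
  assumes "AE \<omega> in M. 0 \<le> f \<omega>"
  shows "ereal_expectation M f = enn2ereal (\<integral>\<^sup>+ \<omega>. e2ennreal (f \<omega>) \<partial>M)"
proof -
  have "(\<integral>\<^sup>+ \<omega>. e2ennreal (- f \<omega>) \<partial>M) = (\<integral>\<^sup>+ \<omega>. 0 \<partial>M)"
    using assms by (intro nn_integral_cong_AE, eventually_elim) (simp add: e2ennreal_neg)
  then show ?thesis by (simp add: ereal_expectation_def zero_ennreal.rep_eq)
qed

text \<open>
  For measurable \<open>u\<close> this is linearity. For arbitrary \<open>u\<close> the integral is a supremum over simple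
  functions, and an affine change of variable turns each simple function below \<open>c * u + d\<close> into one
  below \<open>u\<close>; the truncated subtraction on \<^typ>\<open>ennreal\<close> keeps it nonnegative.
\<close>
lemma nn_integral_affine_bound:
  fixes u v :: "'w \<Rightarrow> ennreal"
  assumes "prob_space M" and c: "0 < c" "c < top" and d: "d < top"
    and le: "\<And>\<omega>. \<omega> \<in> space M \<Longrightarrow> v \<omega> \<le> c * u \<omega> + d"
  shows "(\<integral>\<^sup>+ \<omega>. v \<omega> \<partial>M) \<le> c * (\<integral>\<^sup>+ \<omega>. u \<omega> \<partial>M) + d"
  unfolding nn_integral_def[of M v]
proof (rule SUP_least, clarify)
  interpret prob_space M by fact
  fix s assume s: "simple_function M s" "s \<le> v"
  define t where "t \<omega> = (s \<omega> - d) / c * indicator (space M) \<omega>" for \<omega>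
  have t: "simple_function M t"
    unfolding t_def using s(1)
    by (intro simple_function_mult simple_function_indicator
        simple_function_compose1[OF s(1), of "\<lambda>y. (y - d) / c"]) auto
  have t_le: "t \<omega> \<le> u \<omega>" for \<omega>
  proof (cases "\<omega> \<in> space M")
    case True
    have "s \<omega> \<le> d + c * u \<omega>"
      using le[OF True] s(2) by (metis le_funD order_trans add.commute)
    then have "s \<omega> - d \<le> c * u \<omega>"
      using d by (auto simp: ennreal_minus_le_iff)
    then show ?thesis
      using c True by (simp add: t_def divide_le_posI_ennreal mult.commute)
  qed (simp add: t_def)
  have "integral\<^sup>S M s = (\<integral>\<^sup>+ \<omega>. s \<omega> \<partial>M)"
    using s(1) by (rule nn_integral_eq_simple_integral[symmetric])
  also have "\<dots> \<le> (\<integral>\<^sup>+ \<omega>. c * t \<omega> + d \<partial>M)"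
  proof (rule nn_integral_mono)
    fix \<omega> assume "\<omega> \<in> space M"
    then have "c * t \<omega> = s \<omega> - d"
      using c by (simp add: t_def ennreal_times_divide mult.commute[of c] ennreal_mult_divide_eq)
    then show "s \<omega> \<le> c * t \<omega> + d"
      by (metis add.commute ennreal_minus_le_iff d order_refl top.not_eq_extremum)
  qed
  also have "\<dots> = c * (\<integral>\<^sup>+ \<omega>. t \<omega> \<partial>M) + d"
    using borel_measurable_simple_function[OF t]
    by (simp add: nn_integral_add nn_integral_cmult emeasure_space_1)
  also have "\<dots> \<le> c * (\<integral>\<^sup>+ \<omega>. u \<omega> \<partial>M) + d"
    by (intro add_right_mono mult_left_mono nn_integral_mono t_le) auto
  finally show "integral\<^sup>S M s \<le> c * (\<integral>\<^sup>+ \<omega>. u \<omega> \<partial>M) + d" .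
qed

lemma ereal_expectation_affine_bound:
  assumes M: "prob_space M" and c: "0 < c" and d: "0 \<le> d"
    and u: "\<And>\<omega>. \<omega> \<in> space M \<Longrightarrow> 0 \<le> u \<omega>"
    and le: "\<And>\<omega>. \<omega> \<in> space M \<Longrightarrow> v \<omega> \<le> ereal c * u \<omega> + ereal d"
  shows "ereal_expectation M v \<le> ereal c * ereal_expectation M u + ereal d"
proof -
  let ?U = "\<integral>\<^sup>+ \<omega>. e2ennreal (u \<omega>) \<partial>M" and ?V = "\<integral>\<^sup>+ \<omega>. e2ennreal (v \<omega>) \<partial>M"
  have V: "?V \<le> ennreal c * ?U + ennreal d"
  proof (rule nn_integral_affine_bound[OF M])
    fix \<omega> assume \<omega>: "\<omega> \<in> space M"
    have "e2ennreal (v \<omega>) \<le> e2ennreal (ereal c * u \<omega> + ereal d)"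
      using le[OF \<omega>] by (rule e2ennreal_mono)
    also have "\<dots> = ennreal c * e2ennreal (u \<omega>) + ennreal d"
      using u[OF \<omega>] c d
      by (cases "u \<omega>") (auto simp: ennreal_mult ennreal_mult_top ennreal_plus)
    finally show "e2ennreal (v \<omega>) \<le> ennreal c * e2ennreal (u \<omega>) + ennreal d" .
  qed (use c in auto)
  have "ereal_expectation M v \<le> enn2ereal ?V"
    unfolding ereal_expectation_def
    by (rule ereal_diff_le_self) simp
  also have "\<dots> \<le> enn2ereal (ennreal c * ?U + ennreal d)"
    using V by (simp add: less_eq_ennreal.rep_eq)
  also have "\<dots> = ereal c * enn2ereal ?U + ereal d"
    using c d by (simp add: plus_ennreal.rep_eq times_ennreal.rep_eq)
  also have "enn2ereal ?U = ereal_expectation M u"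
    using u by (intro ereal_expectation_nonneg[symmetric] AE_I2)
  finally show ?thesis .
qed

section \<open>The two risks of a fixed classifier\<close>

text \<open>
  One labelled observation together with a version of its conditional class probability. Such a
  version is determined, and bounded by \<open>0\<close> and \<open>1\<close>, only up to null sets of the law of \<open>X\<close>.
\<close>
locale classification = prob_space M
  for M :: "'w measure" and X :: "'w \<Rightarrow> real ^ 'd2 ^ 'd1" and Y :: "'w \<Rightarrow> real"
    and \<eta> :: "real ^ 'd2 ^ 'd1 \<Rightarrow> real" +
  assumes XY: "(\<lambda>\<omega>. (X \<omega>, Y \<omega>)) \<in> measurable M obs_space"
    and cond_prob: "is_cond_prob_one M X Y \<eta>"
begin

abbreviation PX :: "(real ^ 'd2 ^ 'd1) measure" where
  "PX \<equiv> distr M cube_space X"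

lemma X_measurable [measurable]: "X \<in> measurable M cube_space"
  using measurable_compose[OF XY measurable_fst] by simp

lemma Y_measurable: "Y \<in> measurable M (count_space {-1, 1})"
  using measurable_compose[OF XY measurable_snd] by simp

lemma Y_measurable_real [measurable]: "Y \<in> borel_measurable M"
  using measurable_compose[OF Y_measurable, of "\<lambda>y. y" borel] by simp

lemma Y_cases: "\<omega> \<in> space M \<Longrightarrow> Y \<omega> = -1 \<or> Y \<omega> = 1"
  using measurable_space[OF Y_measurable] by auto

lemma eta_measurable [measurable]: "\<eta> \<in> borel_measurable cube_space"
  using cond_prob by (simp add: is_cond_prob_one_def)

lemma prob_space_PX: "prob_space PX"
  by (rule prob_space_distr) measurable

abbreviation (input) sigma_X :: "'w measure" where
  "sigma_X \<equiv> vimage_algebra (space M) X cube_space"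

lemma finite_measure_subalgebra_sigma_X: "finite_measure_subalgebra M sigma_X"
proof
  show "subalgebra M sigma_X"
    unfolding subalgebra_def
    using X_measurable by (auto simp: measurable_iff_sets)
qed

lemma X_sigma_X: "X \<in> measurable sigma_X cube_space"
  using X_measurable by (intro measurable_vimage_algebra1 funcsetI) (rule measurable_space)

lemma eta_bounds: "AE x in PX. 0 \<le> \<eta> x \<and> \<eta> x \<le> 1"
proof -
  interpret S: finite_measure_subalgebra M sigma_X by (rule finite_measure_subalgebra_sigma_X)
  let ?A = "{\<omega> \<in> space M. Y \<omega> = 1}"
  have int: "integrable M (indicator ?A :: _ \<Rightarrow> real)"
    by (simp add: integrable_indicator_iff emeasure_eq_measure)
  have "AE \<omega> in M. \<eta> (X \<omega>) = real_cond_exp M sigma_X (indicator ?A) \<omega>"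
    using cond_prob by (simp add: is_cond_prob_one_def)
  moreover have "AE \<omega> in M. 0 \<le> real_cond_exp M sigma_X (indicator ?A) \<omega>"
    by (rule S.real_cond_exp_ge_c[OF int]) auto
  moreover have "AE \<omega> in M. real_cond_exp M sigma_X (indicator ?A) \<omega> \<le> 1"
    by (rule S.real_cond_exp_le_c[OF int]) (auto simp: indicator_def)
  ultimately have "AE \<omega> in M. 0 \<le> \<eta> (X \<omega>) \<and> \<eta> (X \<omega>) \<le> 1"
    by eventually_elim auto
  then show ?thesis by (subst AE_distr_iff) auto
qed

lemma risk_conditional:
  assumes g [measurable]: "g \<in> borel_measurable cube_space"
  shows "risk M X Y g = (\<integral>x. (if g x \<le> 0 then \<eta> x else 1 - \<eta> x) \<partial>PX)"
proof -
  interpret S: finite_measure_subalgebra M sigma_X by (rule finite_measure_subalgebra_sigma_X)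
  note X_sigma_X [measurable]
  define A where "A = {\<omega> \<in> space M. Y \<omega> = 1}"
  have A [measurable]: "A \<in> sets M" by (simp add: A_def)
  \<comment> \<open>The error event has indicator \<open>w * 1\<^sub>A + r\<close> with \<open>w\<close> and \<open>r\<close> depending on \<open>X\<close> only, so the
    label enters through \<open>1\<^sub>A\<close> alone and can be replaced by its conditional expectation.\<close>
  define w where "w \<omega> = (if g (X \<omega>) \<le> 0 then 1 else -1 :: real)" for \<omega>
  define r where "r \<omega> = (if g (X \<omega>) \<le> 0 then 0 else 1 :: real)" for \<omega>
  have w [measurable]: "w \<in> borel_measurable sigma_X" unfolding w_def by measurable
  have wM [measurable]: "w \<in> borel_measurable M" unfolding w_def by measurable
  have rM [measurable]: "r \<in> borel_measurable M" unfolding r_def by measurable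
  have int_w: "integrable M (\<lambda>\<omega>. w \<omega> * indicator A \<omega>)"
    by (rule integrable_const_bound[where B = 1]) (auto simp: w_def indicator_def)
  have int_r: "integrable M r"
    by (rule integrable_const_bound[where B = 1]) (auto simp: r_def)
  have "risk M X Y g =
      (\<integral>\<omega>. indicator {\<omega> \<in> space M. Y \<omega> * class_sgn (g (X \<omega>)) \<le> 0} \<omega> \<partial>M)"
    unfolding risk_def by (simp add: class_sgn_def)
  also have "\<dots> = (\<integral>\<omega>. w \<omega> * indicator A \<omega> + r \<omega> \<partial>M)"
  proof (rule Bochner_Integration.integral_cong)
    fix \<omega> assume "\<omega> \<in> space M"
    then show "indicator {\<omega> \<in> space M. Y \<omega> * class_sgn (g (X \<omega>)) \<le> 0} \<omega> =
        w \<omega> * indicator A \<omega> + r \<omega>"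
      using Y_cases[of \<omega>]
      by (auto simp: w_def r_def A_def class_sgn_def indicator_def)
  qed simp
  also have "\<dots> = (\<integral>\<omega>. w \<omega> * indicator A \<omega> \<partial>M) + (\<integral>\<omega>. r \<omega> \<partial>M)"
    using int_w int_r by (rule Bochner_Integration.integral_add)
  also have "(\<integral>\<omega>. w \<omega> * indicator A \<omega> \<partial>M) =
      (\<integral>\<omega>. w \<omega> * real_cond_exp M sigma_X (indicator A) \<omega> \<partial>M)"
    by (rule S.real_cond_exp_intg(2)[OF int_w w, symmetric]) simp
  also have "\<dots> + (\<integral>\<omega>. r \<omega> \<partial>M) =
      (\<integral>\<omega>. w \<omega> * real_cond_exp M sigma_X (indicator A) \<omega> + r \<omega> \<partial>M)"
    by (rule Bochner_Integration.integral_add[symmetric, OF S.real_cond_exp_intg(1)[OF int_w w] int_r])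
      simp
  also have "\<dots> = (\<integral>\<omega>. (if g (X \<omega>) \<le> 0 then \<eta> (X \<omega>) else 1 - \<eta> (X \<omega>)) \<partial>M)"
  proof (rule integral_cong_AE)
    have "AE \<omega> in M. \<eta> (X \<omega>) = real_cond_exp M sigma_X (indicator A) \<omega>"
      using cond_prob by (simp add: is_cond_prob_one_def A_def)
    then show "AE \<omega> in M. w \<omega> * real_cond_exp M sigma_X (indicator A) \<omega> + r \<omega> =
        (if g (X \<omega>) \<le> 0 then \<eta> (X \<omega>) else 1 - \<eta> (X \<omega>))"
      by eventually_elim (simp add: w_def r_def)
  qed (measurable, measurable)
  also have "\<dots> = (\<integral>x. (if g x \<le> 0 then \<eta> x else 1 - \<eta> x) \<partial>PX)"
    by (subst integral_distr) auto
  finally show ?thesis .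
qed

lemma excess_risk_eq:
  assumes g [measurable]: "g \<in> borel_measurable cube_space"
  shows "excess_risk M X Y g (f_star \<eta>) = (\<integral>x. excess_loss (\<eta> x) (g x) \<partial>PX)"
proof -
  interpret PX: prob_space PX by (rule prob_space_PX)
  have f [measurable]: "f_star \<eta> \<in> borel_measurable cube_space"
    unfolding f_star_def by measurable
  have int: "integrable PX (\<lambda>x. if h x \<le> 0 then \<eta> x else 1 - \<eta> x)"
    if [measurable]: "h \<in> borel_measurable cube_space" for h :: "_ \<Rightarrow> real"
    by (rule PX.integrable_const_bound[where B = 1], rule eventually_mono[OF eta_bounds]) auto
  have "excess_risk M X Y g (f_star \<eta>) = (\<integral>x. (if g x \<le> 0 then \<eta> x else 1 - \<eta> x) -
      (if f_star \<eta> x \<le> 0 then \<eta> x else 1 - \<eta> x) \<partial>PX)"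
    unfolding excess_risk_def risk_conditional[OF g] risk_conditional[OF f]
    by (rule Bochner_Integration.integral_diff[OF int[OF g] int[OF f], symmetric])
  also have "\<dots> = (\<integral>x. excess_loss (\<eta> x) (g x) \<partial>PX)"
    by (rule Bochner_Integration.integral_cong)
      (auto simp: excess_loss_def f_star_def)
  finally show ?thesis .
qed

text \<open>
  Wherever \<open>\<eta>\<close> is a probability, the conditional loss is a finite number both for real classifiers
  and for \<open>f_phi_star\<close>. The \<open>\<phi>\<close>-risks then become integrals of ordinary real functions.
\<close>
lemma phi_risk_nn_integral:
  assumes g: "g \<in> borel_measurable cube_space"
    and h: "\<And>x. 0 \<le> \<eta> x \<Longrightarrow> \<eta> x \<le> 1 \<Longrightarrow> 0 \<le> h x \<and> ereal (\<eta> x) * ereal_logistic_loss (g x) +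
      ereal (1 - \<eta> x) * ereal_logistic_loss (- g x) = ereal (h x)"
  shows "phi_risk M X Y g = enn2ereal (\<integral>\<^sup>+ x. ennreal (h x) \<partial>PX)"
proof -
  let ?f = "\<lambda>x. ereal (\<eta> x) * ereal_logistic_loss (g x) +
      ereal (1 - \<eta> x) * ereal_logistic_loss (- g x)"
  have "phi_risk M X Y g = ereal_expectation PX ?f"
    by (rule phi_risk_conditional[OF prob_space_axioms XY cond_prob g])
  also have "\<dots> = enn2ereal (\<integral>\<^sup>+ x. e2ennreal (?f x) \<partial>PX)"
    by (rule ereal_expectation_nonneg, rule eventually_mono[OF eta_bounds]) (simp add: h)
  also have "(\<integral>\<^sup>+ x. e2ennreal (?f x) \<partial>PX) = (\<integral>\<^sup>+ x. ennreal (h x) \<partial>PX)"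
    by (rule nn_integral_cong_AE, rule eventually_mono[OF eta_bounds]) (simp add: h)
  finally show ?thesis .
qed

lemma phi_risk_real:
  assumes [measurable]: "g \<in> borel_measurable cube_space"
  shows "phi_risk M X Y (\<lambda>x. ereal (g x)) =
    enn2ereal (\<integral>\<^sup>+ x. ennreal (pointwise_risk (\<eta> x) (g x)) \<partial>PX)"
proof (rule phi_risk_nn_integral)
  show "(\<lambda>x. ereal (g x)) \<in> borel_measurable cube_space" by measurable
qed (simp only: conditional_loss_real pointwise_risk_nonneg simp_thms)

lemma phi_risk_f_phi_star:
  "phi_risk M X Y (f_phi_star \<eta>) = enn2ereal (\<integral>\<^sup>+ x. ennreal (bernoulli_entropy (\<eta> x)) \<partial>PX)"
proof (rule phi_risk_nn_integral)
  show "f_phi_star \<eta> \<in> borel_measurable cube_space"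
    unfolding f_phi_star_def by measurable
qed (simp add: conditional_loss_f_phi_star bernoulli_entropy_nonneg)

lemma phi_risk_f_phi_star_finite:
  obtains h where "0 \<le> h" "phi_risk M X Y (f_phi_star \<eta>) = ereal h"
proof -
  interpret PX: prob_space PX by (rule prob_space_PX)
  have "AE x in PX. ennreal (bernoulli_entropy (\<eta> x)) \<le> ennreal (ln 2)"
    using eta_bounds
    by eventually_elim (intro ennreal_leI order_trans[OF bernoulli_entropy_upper], auto)
  then have "(\<integral>\<^sup>+ x. ennreal (bernoulli_entropy (\<eta> x)) \<partial>PX) \<le> (\<integral>\<^sup>+ x. ennreal (ln 2) \<partial>PX)"
    by (rule nn_integral_mono_AE)
  also have "\<dots> < top" using PX.emeasure_space_1 by simp
  finally show thesis
    using that unfolding phi_risk_f_phi_star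
    by (cases "\<integral>\<^sup>+ x. ennreal (bernoulli_entropy (\<eta> x)) \<partial>PX") auto
qed

text \<open>
  The pointwise calibration inequality, integrated. It is kept in additive form, with the entropy on
  the side of the squared excess loss, until the finite integral of the entropy is subtracted at the
  end, because the \<open>\<phi>\<close>-risk of \<open>g\<close> may be infinite.
\<close>
lemma excess_phi_risk_lower:
  assumes g [measurable]: "g \<in> borel_measurable cube_space"
  shows "ereal ((excess_risk M X Y g (f_star \<eta>))\<^sup>2 / 2)
    \<le> excess_phi_risk M X Y (\<lambda>x. ereal (g x)) (f_phi_star \<eta>)"
proof -
  interpret PX: prob_space PX by (rule prob_space_PX)
  define D where "D x = excess_loss (\<eta> x) (g x)" for x
  have D [measurable]: "D \<in> borel_measurable cube_space"
    unfolding D_def excess_loss_def by measurable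
  have D_bound: "AE x in PX. \<bar>D x\<bar> \<le> 1"
    using eta_bounds by eventually_elim (auto simp: D_def excess_loss_def)
  have int_D: "integrable PX D"
    by (rule PX.integrable_const_bound[where B = 1]) (use D_bound in auto)
  have int_D2: "integrable PX (\<lambda>x. (D x)\<^sup>2)"
    by (rule PX.integrable_const_bound[where B = 1])
      (use D_bound in \<open>auto simp: abs_square_le_1\<close>)
  let ?H = "\<integral>\<^sup>+ x. ennreal (bernoulli_entropy (\<eta> x)) \<partial>PX"
  let ?C = "\<integral>\<^sup>+ x. ennreal (pointwise_risk (\<eta> x) (g x)) \<partial>PX"
  \<comment> \<open>Jensen's inequality for the square, in the form that a variance is nonnegative.\<close>
  have "(\<integral>x. D x \<partial>PX)\<^sup>2 \<le> (\<integral>x. (D x)\<^sup>2 \<partial>PX)"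
    using PX.variance_eq[OF int_D int_D2] PX.variance_positive[of D] by simp
  then have "ennreal ((\<integral>x. D x \<partial>PX)\<^sup>2 / 2) + ?H \<le> ennreal (\<integral>x. (D x)\<^sup>2 / 2 \<partial>PX) + ?H"
    by (intro add_right_mono ennreal_leI) simp
  also have "ennreal (\<integral>x. (D x)\<^sup>2 / 2 \<partial>PX) = (\<integral>\<^sup>+ x. ennreal ((D x)\<^sup>2 / 2) \<partial>PX)"
    using int_D2 by (intro nn_integral_eq_integral[symmetric]) auto
  also have "\<dots> + ?H = (\<integral>\<^sup>+ x. ennreal ((D x)\<^sup>2 / 2) + ennreal (bernoulli_entropy (\<eta> x)) \<partial>PX)"
    by (rule nn_integral_add[symmetric]) (auto simp: bernoulli_entropy_def)
  also have "\<dots> \<le> ?C"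
  proof (rule nn_integral_mono_AE)
    show "AE x in PX. ennreal ((D x)\<^sup>2 / 2) + ennreal (bernoulli_entropy (\<eta> x))
        \<le> ennreal (pointwise_risk (\<eta> x) (g x))"
      using eta_bounds
      by eventually_elim
        (auto simp: D_def excess_loss_calibration bernoulli_entropy_nonneg
          simp flip: ennreal_plus intro!: ennreal_leI)
  qed
  finally have "enn2ereal (ennreal ((\<integral>x. D x \<partial>PX)\<^sup>2 / 2) + ?H) \<le> enn2ereal ?C"
    by (simp add: less_eq_ennreal.rep_eq)
  then have le: "ereal ((\<integral>x. D x \<partial>PX)\<^sup>2 / 2) + phi_risk M X Y (f_phi_star \<eta>)
      \<le> phi_risk M X Y (\<lambda>x. ereal (g x))"
    by (simp add: phi_risk_real phi_risk_f_phi_star plus_ennreal.rep_eq)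
  obtain h where "phi_risk M X Y (f_phi_star \<eta>) = ereal h"
    by (rule phi_risk_f_phi_star_finite)
  with le show ?thesis
    by (cases "phi_risk M X Y (\<lambda>x. ereal (g x))")
      (auto simp: excess_phi_risk_def excess_risk_eq[OF g] D_def)
qed

lemma excess_risk_le_sqrt_excess_phi_risk:
  assumes g: "g \<in> borel_measurable cube_space"
  shows "ereal (excess_risk M X Y g (f_star \<eta>))
    \<le> ereal (sqrt 2) * ereal_sqrt (excess_phi_risk M X Y (\<lambda>x. ereal (g x)) (f_phi_star \<eta>))"
    (is "ereal ?r \<le> _ * ereal_sqrt ?e")
proof (cases ?e)
  case (real e)
  then have "?r\<^sup>2 \<le> 2 * e" using excess_phi_risk_lower[OF g] by simp
  then have "?r \<le> sqrt (2 * e)" by (rule real_le_rsqrt)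
  then show ?thesis by (simp add: real ereal_sqrt_def real_sqrt_mult)
qed (use excess_phi_risk_lower[OF g] in \<open>auto simp: ereal_sqrt_def\<close>)

text \<open>
  A misclassified point satisfies \<open>Y g(X) \<le> 0\<close>, and there the logistic loss is at least
  \<open>\<phi>(0) = ln 2 \<ge> 1 / 2\<close>.
\<close>
lemma risk_le_phi_risk:
  assumes g [measurable]: "g \<in> borel_measurable cube_space"
  shows "ereal (risk M X Y g) \<le> 2 * phi_risk M X Y (\<lambda>x. ereal (g x))"
proof -
  let ?E = "{\<omega> \<in> space M. Y \<omega> * class_sgn (g (X \<omega>)) \<le> 0}"
  let ?L = "\<integral>\<^sup>+ \<omega>. ennreal (logistic_loss (Y \<omega> * g (X \<omega>))) \<partial>M"
  have [measurable]: "?E \<in> sets M" unfolding class_sgn_def by measurable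
  have "ennreal (risk M X Y g) = (\<integral>\<^sup>+ \<omega>. indicator ?E \<omega> \<partial>M)"
    by (simp add: risk_def emeasure_eq_measure)
  also have "\<dots> \<le> (\<integral>\<^sup>+ \<omega>. 2 * ennreal (logistic_loss (Y \<omega> * g (X \<omega>))) \<partial>M)"
  proof (rule nn_integral_mono)
    fix \<omega> assume \<omega>: "\<omega> \<in> space M"
    have "1 \<le> 2 * logistic_loss (Y \<omega> * g (X \<omega>))" if "\<omega> \<in> ?E"
    proof -
      have "Y \<omega> * g (X \<omega>) \<le> 0"
        using that Y_cases[OF \<omega>] by (auto simp: class_sgn_def split: if_splits)
      then have "ln 2 \<le> logistic_loss (Y \<omega> * g (X \<omega>))"
        by (simp add: logistic_loss_def add_pos_pos)
      then show ?thesis using ln2_ge_two_thirds by simp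
    qed
    then have "ennreal 1 \<le> ennreal (2 * logistic_loss (Y \<omega> * g (X \<omega>)))" if "\<omega> \<in> ?E"
      using that by (intro ennreal_leI)
    then show "indicator ?E \<omega> \<le> 2 * ennreal (logistic_loss (Y \<omega> * g (X \<omega>)))"
      by (auto simp: indicator_def ennreal_mult' logistic_loss_def)
  qed
  also have "\<dots> = 2 * ?L"
    by (rule nn_integral_cmult) (simp add: logistic_loss_def)
  finally have "enn2ereal (ennreal (risk M X Y g)) \<le> enn2ereal (2 * ?L)"
    by (simp only: less_eq_ennreal.rep_eq)
  also have "\<dots> = 2 * enn2ereal ?L"
    by (simp add: times_ennreal.rep_eq)
  also have "enn2ereal ?L = phi_risk M X Y (\<lambda>x. ereal (g x))"
    unfolding phi_risk_def
    by (subst ereal_expectation_nonneg) (auto simp: ereal_logistic_loss_nonneg,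
        simp add: ereal_logistic_loss_def)
  finally show ?thesis by (simp add: risk_def)
qed

text \<open>
  Writing \<open>h\<close> for the \<open>\<phi>\<close>-risk of \<open>f_phi_star\<close>, twice the \<open>\<phi>\<close>-risk of \<open>g\<close> is twice the excess
  plus \<open>2 h\<close>, and \<open>2 h \<le> 4 h\<close>.
\<close>
lemma excess_risk_le_excess_phi_risk:
  assumes g: "g \<in> borel_measurable cube_space"
  shows "ereal (excess_risk M X Y g (f_star \<eta>))
    \<le> 2 * excess_phi_risk M X Y (\<lambda>x. ereal (g x)) (f_phi_star \<eta>)
      + 4 * phi_risk M X Y (f_phi_star \<eta>)"
proof -
  obtain h where h: "0 \<le> h" "phi_risk M X Y (f_phi_star \<eta>) = ereal h"
    by (rule phi_risk_f_phi_star_finite)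
  have "excess_risk M X Y g (f_star \<eta>) \<le> risk M X Y g"
    by (simp add: excess_risk_def risk_def)
  with risk_le_phi_risk[OF g] h show ?thesis
    by (cases "phi_risk M X Y (\<lambda>x. ereal (g x))") (auto simp: excess_phi_risk_def)
qed

end

theorem lemma1:
  fixes M :: "'w measure"
    and X :: "'w \<Rightarrow> real ^ 'd2 ^ 'd1"
    and Y :: "'w \<Rightarrow> real"
    and n :: nat
    and Xs :: "nat \<Rightarrow> 'w \<Rightarrow> real ^ 'd2 ^ 'd1"
    and Ys :: "nat \<Rightarrow> 'w \<Rightarrow> real"
    and \<eta> :: "real ^ 'd2 ^ 'd1 \<Rightarrow> real"
    and F :: "(real ^ 'd2 ^ 'd1 \<Rightarrow> real) set"
    and fhat :: "(nat \<Rightarrow> (real ^ 'd2 ^ 'd1) \<times> real) \<Rightarrow> real ^ 'd2 ^ 'd1 \<Rightarrow> real"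
  assumes "prob_space M"
    and "1 \<le> n"
    and "iid_sample M X Y n Xs Ys"
    and "is_cond_prob_one M X Y \<eta>"
    and "F \<subseteq> borel_measurable cube_space"
    and "\<And>\<omega>. \<omega> \<in> space M \<Longrightarrow>
           is_arg_min (empirical_phi_risk n (training_data n Xs Ys \<omega>)) (\<lambda>g. g \<in> F)
             (fhat (training_data n Xs Ys \<omega>))"
  shows "ereal_expectation M
           (\<lambda>\<omega>. ereal (excess_risk M X Y (fhat (training_data n Xs Ys \<omega>)) (f_star \<eta>)))
         \<le> ereal (sqrt 2) * ereal_expectation M
           (\<lambda>\<omega>. ereal_sqrt (excess_phi_risk M X Y
                   (\<lambda>x. ereal (fhat (training_data n Xs Ys \<omega>) x)) (f_phi_star \<eta>)))
       \<and> ereal_expectation M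
           (\<lambda>\<omega>. ereal (excess_risk M X Y (fhat (training_data n Xs Ys \<omega>)) (f_star \<eta>)))
         \<le> 2 * ereal_expectation M
           (\<lambda>\<omega>. excess_phi_risk M X Y
                   (\<lambda>x. ereal (fhat (training_data n Xs Ys \<omega>) x)) (f_phi_star \<eta>))
           + 4 * phi_risk M X Y (f_phi_star \<eta>)"
proof -
  interpret prob_space M by fact
  have "indep_vars (\<lambda>_. obs_space)
      (\<lambda>i \<omega>. if i = 0 then (X \<omega>, Y \<omega>) else (Xs i \<omega>, Ys i \<omega>)) {0..n}"
    using assms(3) by (simp add: iid_sample_def)
  then have XY: "(\<lambda>\<omega>. (X \<omega>, Y \<omega>)) \<in> measurable M obs_space"
    unfolding indep_vars_def by (auto dest!: bspec[where x = 0])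
  interpret classification M X Y \<eta>
    by unfold_locales (fact XY, fact assms(4))
  let ?g = "\<lambda>\<omega>. fhat (training_data n Xs Ys \<omega>)"
  let ?r = "\<lambda>\<omega>. excess_risk M X Y (?g \<omega>) (f_star \<eta>)"
  let ?e = "\<lambda>\<omega>. excess_phi_risk M X Y (\<lambda>x. ereal (?g \<omega> x)) (f_phi_star \<eta>)"
  have g: "?g \<omega> \<in> borel_measurable cube_space" if "\<omega> \<in> space M" for \<omega>
    using assms(6)[OF that] assms(5) by (auto simp: is_arg_min_def)
  have e: "0 \<le> ?e \<omega>" if "\<omega> \<in> space M" for \<omega>
    using excess_phi_risk_lower[OF g[OF that]] by (rule order_trans[rotated]) simp
  have sqrt_e: "0 \<le> ereal_sqrt (?e \<omega>)" if "\<omega> \<in> space M" for \<omega>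
    using e[OF that] by (cases "?e \<omega>") (auto simp: ereal_sqrt_def)
  obtain h where h: "0 \<le> h" "phi_risk M X Y (f_phi_star \<eta>) = ereal h"
    by (rule phi_risk_f_phi_star_finite)
  have "ereal_expectation M (\<lambda>\<omega>. ereal (?r \<omega>))
      \<le> ereal (sqrt 2) * ereal_expectation M (\<lambda>\<omega>. ereal_sqrt (?e \<omega>)) + ereal 0"
    using excess_risk_le_sqrt_excess_phi_risk[OF g] sqrt_e
    by (intro ereal_expectation_affine_bound) (auto intro: prob_space_axioms)
  moreover have "ereal_expectation M (\<lambda>\<omega>. ereal (?r \<omega>))
      \<le> ereal 2 * ereal_expectation M ?e + ereal (4 * h)"
    using excess_risk_le_excess_phi_risk[OF g] e h
    by (intro ereal_expectation_affine_bound) (auto intro: prob_space_axioms)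
  ultimately show ?thesis by (simp add: h)
qed

end
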